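(* For every odd integer $d\geq 5$, the $d$-dimensional Cohn-Elkies linear programming bound (i.e., the Cohn-Elkies linear programming bound in $\mathbb{R}^d$) is greater than or equal to $\frac{1}{2(d+1)}$.
   Context: Fourier transform on $\mathbb{R}^d$: $\widehat f(y)=\int_{\mathbb{R}^d} f(x)e^{-2\pi i\langle x,y\rangle}\,dx$, where $\langle x,y\rangle=x_1y_1+\cdots+x_dy_d$. A function $f:\mathbb{R}^d\to\mathbb{R}$ is rapidly decreasing if $f(x)=O\left((1+|x|)^{-k}\right)$ for all positive integers $k$; it is radial if $f(x)$ depends only on $|x|$. For fixed $r>0$ and positive integer $d$, the Cohn-Elkies linear programming bound in $\mathbb{R}^d$ is the infimum of $\left(\frac r2\right)^d f(0)$ over all radial, smooth, rapidly decreasing functions $f:\mathbb{R}^d\to\mathbb{R}$ such that $f(0)>0$; $\widehat f(0)\geq 1$; $f(x)\leq 0$ for all $|x|\geq r$; and $\widehat f(y)\geq 0$ for all $y\in\mathbb{R}^d$. This value does not depend on $r$ (by rescaling $f$). *)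

theory Defs
  imports "HOL-Analysis.Analysis" "HOL-Library.Complex_Order"
begin

text \<open>Iterating over all directional derivatives is equivalent to iterating over all partial
  derivatives; requiring (Frechet) differentiability at each step gives the usual
  notion of a \<open>k\<close> times continuously differentiable function on the whole space.\<close>

primrec times_cont_differentiable :: "nat \<Rightarrow> ('a::euclidean_space \<Rightarrow> real) \<Rightarrow> bool" where
  "times_cont_differentiable 0 f \<longleftrightarrow> continuous_on UNIV f"
| "times_cont_differentiable (Suc k) f \<longleftrightarrow>
     (\<forall>x. f differentiable (at x)) \<and>
     (\<forall>v. times_cont_differentiable k (\<lambda>x. frechet_derivative f (at x) v))"

definition smooth :: "('a::euclidean_space \<Rightarrow> real) \<Rightarrow> bool" where
  "smooth f \<longleftrightarrow> (\<forall>k. times_cont_differentiable k f)"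

definition rapidly_decreasing :: "('a::euclidean_space \<Rightarrow> real) \<Rightarrow> bool" where
  "rapidly_decreasing f \<longleftrightarrow> (\<forall>k\<ge>1. \<exists>C. \<forall>x. \<bar>f x\<bar> \<le> C * inverse ((1 + norm x) ^ k))"

definition radial :: "('a::euclidean_space \<Rightarrow> real) \<Rightarrow> bool" where
  "radial f \<longleftrightarrow> (\<forall>x y. norm x = norm y \<longrightarrow> f x = f y)"

definition fourier :: "('a::euclidean_space \<Rightarrow> real) \<Rightarrow> 'a \<Rightarrow> complex" where
  "fourier f y =
     (LINT x|lborel. complex_of_real (f x) * exp (- 2 * complex_of_real pi * \<i> * complex_of_real (x \<bullet> y)))"

text \<open>The inequalities on the Fourier transform use the partial order on the complex numbers in
  which \<open>a \<le> b\<close> holds iff \<open>b - a\<close> is a nonnegative real. No condition is added by the reality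
  part, since the Fourier transform of a real-valued radial function is real-valued.\<close>

definition cohn_elkies_admissible :: "real \<Rightarrow> ('a::euclidean_space \<Rightarrow> real) \<Rightarrow> bool" where
  "cohn_elkies_admissible r f \<longleftrightarrow>
     radial f \<and> smooth f \<and> rapidly_decreasing f \<and>
     f 0 > 0 \<and> fourier f 0 \<ge> 1 \<and>
     (\<forall>x. norm x \<ge> r \<longrightarrow> f x \<le> 0) \<and>
     (\<forall>y. fourier f y \<ge> 0)"

text \<open>The dimension is the cardinality of the index type. The infimum is taken in the extended
  reals, because on \<open>real\<close> the value of \<open>Inf\<close> is unspecified for the empty set.\<close>

definition cohn_elkies_bound :: "'n::finite itself \<Rightarrow> real \<Rightarrow> ereal" where
  "cohn_elkies_bound _ r =
     (INF f \<in> {f :: real ^ 'n \<Rightarrow> real. cohn_elkies_admissible r f}.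
        ereal ((r / 2) ^ CARD('n) * f 0))"

end

theory Submission
  imports Defs
begin

text \<open>
  Write \<open>d\<close> for the dimension. The bound is the density of a packing that need not exist: the one
  that Construction A would attach to a binary code of odd length \<open>d\<close>, minimal distance \<open>4\<close> and size
  \<open>2 ^ (d - 1) / (d + 1)\<close>. For \<open>d + 1\<close> a power of two such a code exists (shorten the extended
  Hamming code), and its dual consists of words of weights \<open>0\<close>, \<open>(d - 1) / 2\<close>, \<open>(d + 1) / 2\<close> and
  \<open>d\<close>. For other odd \<open>d\<close> there remains a weight function \<open>a\<close> on the subsets of the set of
  coordinates that behaves as the indicator function of this code, averaged over permutations of the
  coordinates: \<open>a {} = 1\<close>; \<open>a V = 0\<close> when \<open>0 < card V < 4\<close>; \<open>a \<ge> 0\<close>; and \<open>a\<close> is a nonnegative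
  combination of characters of the group of subsets, the trivial character having coefficient
  \<open>1 / (2 * (d + 1))\<close>. This is \<open>code_weight\<close>. The delicate property is \<open>a \<ge> 0\<close>
  (\<open>code_weight_nonneg\<close>), which needs a sharp estimate of a Krawtchouk sum.

  Fix \<open>s > r / 2\<close> and put mass \<open>a V\<close> at every point of \<open>s\<close> times the integer lattice whose set of
  odd coordinates is \<open>V\<close>. Every point of positive mass other than the origin has norm at least
  \<open>2 * s > r\<close>, since either it has at least four odd coordinates or all its coordinates are even. Hence the
  integral of an admissible \<open>f\<close> against this measure is at most \<open>f 0\<close>. On the other hand the
  measure has a nonnegative Fourier transform, so that the integral is at least the contribution
  of the zero frequency, which is \<open>fourier f 0 \<ge> 1\<close> times the mean density
  \<open>2 ^ d / (2 * (d + 1)) / (2 * s) ^ d\<close>. Comparing the two gives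
  \<open>1 / (2 * (d + 1)) \<le> s ^ d * f 0\<close>, and \<open>s\<close> can be moved down to \<open>r / 2\<close>.

  To make this rigorous without Poisson summation, the measure is replaced by trigonometric
  polynomials \<open>code_kernel s N\<close>, which are nonnegative, have nonnegative coefficients, and
  concentrate at the points of the measure as \<open>N\<close> grows. The lower bound for the integral then
  is a finite sum of values of \<open>fourier f\<close> (\<open>kernel_integral_lower_bound\<close>), and for the upper bound
  (\<open>kernel_integral_upper_bound\<close>) only the ball where \<open>f\<close> can be positive matters; on it the kernel
  is exponentially small away from the origin.
\<close>

section \<open>Character sums over the half-size subsets\<close>

text \<open>The value at the coordinate \<open>i\<close> of the sign vector that encodes \<open>S\<close>; products over \<open>i \<in> V\<close>
  give the characters of the group of subsets. It also records the shift by half a period that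
  moves a bump of the kernel to the vertex \<open>S\<close> of the cube.\<close>

definition set_sign :: "'a set \<Rightarrow> 'a \<Rightarrow> real" where
  "set_sign S i = (if i \<in> S then - 1 else 1)"

definition halves :: "'a set \<Rightarrow> 'a set set" where
  "halves X = {S. S \<subseteq> X \<and> 2 * card S = card X}"

text \<open>This is a Krawtchouk polynomial at its middle index, evaluated at \<open>card V\<close>.\<close>

definition halves_sum :: "'a set \<Rightarrow> 'a set \<Rightarrow> real" where
  "halves_sum X V = (\<Sum>S\<in>halves X. \<Prod>i\<in>V. set_sign S i)"

lemma finite_halves: "finite X \<Longrightarrow> finite (halves X)"
  unfolding halves_def by (rule finite_subset[of _ "Pow X"]) auto

lemma halves_sum_empty: "halves_sum X {} = card (halves X)"
  by (simp add: halves_sum_def)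

lemma halves_nonempty:
  assumes "even (card X)"
  shows "halves X \<noteq> {}"
proof -
  obtain S where "S \<subseteq> X" "card S = card X div 2"
    by (rule obtain_subset_with_card_n[of "card X div 2" X]) auto
  with assms have "S \<in> halves X" by (auto simp: halves_def)
  then show ?thesis by auto
qed

lemma halves_sum_empty_pos:
  assumes "finite X" "even (card X)"
  shows "halves_sum X {} > 0"
  using assms halves_nonempty[of X] finite_halves[of X]
  by (simp add: halves_sum_empty card_gt_0_iff)

lemma abs_halves_sum_le: "\<bar>halves_sum X V\<bar> \<le> halves_sum X {}"
proof -
  have "\<bar>\<Prod>i\<in>V. set_sign S i\<bar> = 1" for S
    unfolding abs_prod by (rule prod.neutral) (auto simp: set_sign_def)
  then have "\<bar>halves_sum X V\<bar> \<le> (\<Sum>S\<in>halves X. 1)"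
    unfolding halves_sum_def by (intro order_trans[OF sum_abs] sum_mono) simp
  then show ?thesis by (simp add: halves_sum_empty)
qed

text \<open>A bijection of \<open>X\<close> that carries \<open>V\<close> to \<open>V'\<close> permutes the half-size subsets.\<close>

lemma halves_sum_card_cong:
  assumes "finite X" "V \<subseteq> X" "V' \<subseteq> X" "card V = card V'"
  shows "halves_sum X V = halves_sum X V'"
proof -
  have fin: "finite V" "finite V'"
    using assms finite_subset by blast+
  obtain f where f: "bij_betw f V V'"
    using finite_same_card_bij[OF fin assms(4)] by blast
  have "card (X - V) = card (X - V')"
    using assms fin by (simp add: card_Diff_subset)
  then obtain g where g: "bij_betw g (X - V) (X - V')"
    using finite_same_card_bij[of "X - V" "X - V'"] assms(1) by blast
  define h where "h = (\<lambda>x. if x \<in> V then f x else g x)"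
  have hV: "bij_betw h V V'" and hX': "bij_betw h (X - V) (X - V')"
    using f g by (auto simp: h_def bij_betw_def inj_on_def image_def)
  have "bij_betw h (V \<union> (X - V)) (V' \<union> (X - V'))"
    by (rule bij_betw_combine[OF hV hX']) auto
  then have hX: "bij_betw h X X"
    using assms(2,3) by (simp add: Un_absorb1)
  have injX: "inj_on h X" and imX: "h ` X = X"
    using hX by (auto simp: bij_betw_def)
  have inj: "inj_on ((`) h) (halves X)"
    by (rule inj_on_subset[OF inj_on_image_Pow[OF injX]]) (auto simp: halves_def)
  have sub: "(`) h ` halves X \<subseteq> halves X"
  proof
    fix T assume "T \<in> (`) h ` halves X"
    then obtain S where S: "T = h ` S" "S \<subseteq> X" "2 * card S = card X"
      by (auto simp: halves_def)
    then have "card T = card S"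
      using injX by (metis card_image inj_on_subset)
    then show "T \<in> halves X" using S imX by (auto simp: halves_def)
  qed
  have onto: "(`) h ` halves X = halves X"
    by (rule endo_inj_surj[OF finite_halves[OF assms(1)] sub inj])
  have "halves_sum X V' = (\<Sum>S\<in>(`) h ` halves X. \<Prod>i\<in>V'. set_sign S i)"
    by (simp add: halves_sum_def onto)
  also have "\<dots> = (\<Sum>S\<in>halves X. \<Prod>i\<in>V'. set_sign (h ` S) i)"
    by (simp add: sum.reindex[OF inj])
  also have "\<dots> = halves_sum X V"
    unfolding halves_sum_def
  proof (rule sum.cong[OF refl])
    fix S assume "S \<in> halves X"
    then have SX: "S \<subseteq> X" by (auto simp: halves_def)
    show "(\<Prod>i\<in>V'. set_sign (h ` S) i) = (\<Prod>i\<in>V. set_sign S i)"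
    proof (rule prod.reindex_bij_betw[OF hV, symmetric, THEN trans], rule prod.cong[OF refl])
      fix i assume "i \<in> V"
      with SX assms(2) have "h i \<in> h ` S \<longleftrightarrow> i \<in> S"
        using injX by (auto dest: inj_onD)
      then show "set_sign (h ` S) (h i) = set_sign S i" by (simp add: set_sign_def)
    qed
  qed
  finally show ?thesis by simp
qed

text \<open>A half-size subset has as many signs \<open>- 1\<close> as signs \<open>1\<close>, so its signs add up to zero. Multiplying
  this relation by the character of \<open>V\<close> adds or removes one element of \<open>V\<close> in each term.\<close>

lemma halves_sum_neighbours:
  assumes "finite X" "V \<subseteq> X"
  shows "(\<Sum>i\<in>V. halves_sum X (V - {i})) + (\<Sum>i\<in>X - V. halves_sum X (insert i V)) = 0"
proof -
  have finV: "finite V" using assms finite_subset by blast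
  have rem: "(\<Prod>k\<in>V - {i}. set_sign S k) = set_sign S i * (\<Prod>k\<in>V. set_sign S k)"
    if "i \<in> V" for i S
    unfolding prod.remove[OF finV that] by (auto simp: set_sign_def)
  have ins: "(\<Prod>k\<in>insert i V. set_sign S k) = set_sign S i * (\<Prod>k\<in>V. set_sign S k)"
    if "i \<in> X - V" for i S
    using that finV by simp
  have bal: "(\<Sum>i\<in>X. set_sign S i) = 0" if "S \<in> halves X" for S
  proof -
    have S: "S \<subseteq> X" "2 * card S = card X" using that by (auto simp: halves_def)
    have "finite S" using S assms(1) finite_subset by blast
    have "(\<Sum>i\<in>X. set_sign S i) = (\<Sum>i\<in>X - S. set_sign S i) + (\<Sum>i\<in>S. set_sign S i)"
      by (rule sum.subset_diff[OF S(1) assms(1)])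
    also have "\<dots> = real (card (X - S)) - real (card S)"
      by (simp add: set_sign_def)
    also have "card (X - S) = card S"
      using S \<open>finite S\<close> by (simp add: card_Diff_subset)
    finally show ?thesis by simp
  qed
  have "(\<Sum>i\<in>V. halves_sum X (V - {i})) + (\<Sum>i\<in>X - V. halves_sum X (insert i V))
    = (\<Sum>i\<in>V. \<Sum>S\<in>halves X. set_sign S i * (\<Prod>k\<in>V. set_sign S k))
    + (\<Sum>i\<in>X - V. \<Sum>S\<in>halves X. set_sign S i * (\<Prod>k\<in>V. set_sign S k))"
    unfolding halves_sum_def using rem ins by (intro arg_cong2[of _ _ _ _ "(+)"] sum.cong) auto
  also have "\<dots> = (\<Sum>i\<in>X. \<Sum>S\<in>halves X. set_sign S i * (\<Prod>k\<in>V. set_sign S k))"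
    by (subst sum.subset_diff[OF assms(2,1)]) simp
  also have "\<dots> = (\<Sum>S\<in>halves X. (\<Sum>i\<in>X. set_sign S i) * (\<Prod>k\<in>V. set_sign S k))"
    by (subst sum.swap) (simp add: sum_distrib_right)
  also have "\<dots> = 0" by (simp add: bal)
  finally show ?thesis .
qed

text \<open>As the sum depends on the size of \<open>V\<close> only, the relation between neighbours becomes a two-step
  recurrence in that size.\<close>

lemma halves_sum_profile:
  assumes "finite X"
  obtains m where "\<And>V. V \<subseteq> X \<Longrightarrow> halves_sum X V = m (card V)"
    and "\<And>j. j \<le> card X \<Longrightarrow> real j * m (j - 1) + (real (card X) - real j) * m (Suc j) = 0"
proof -
  define m where "m j = halves_sum X (SOME V. V \<subseteq> X \<and> card V = j)" for j
  have m: "halves_sum X V = m (card V)" if "V \<subseteq> X" for V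
  proof -
    have "(SOME W. W \<subseteq> X \<and> card W = card V) \<subseteq> X \<and> card (SOME W. W \<subseteq> X \<and> card W = card V) = card V"
      by (rule someI[of "\<lambda>W. W \<subseteq> X \<and> card W = card V" V]) (use that in simp)
    then show ?thesis unfolding m_def using that
      by (intro halves_sum_card_cong[OF assms]) auto
  qed
  have "real j * m (j - 1) + (real (card X) - real j) * m (Suc j) = 0" if j: "j \<le> card X" for j
  proof -
    obtain V where V: "V \<subseteq> X" "card V = j" "finite V"
      using obtain_subset_with_card_n[OF j] by metis
    have "(\<Sum>i\<in>V. halves_sum X (V - {i})) = (\<Sum>i\<in>V. m (j - 1))"
      using V by (intro sum.cong refl) (subst m, auto)
    moreover have "(\<Sum>i\<in>X - V. halves_sum X (insert i V)) = (\<Sum>i\<in>X - V. m (Suc j))"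
      using V by (intro sum.cong refl) (subst m, auto)
    moreover have "real (card (X - V)) = real (card X) - real j"
      using V j by (simp add: card_Diff_subset of_nat_diff)
    ultimately show ?thesis
      using halves_sum_neighbours[OF assms V(1)] V(2) by simp
  qed
  with m show ?thesis by (rule that)
qed

text \<open>The recurrence multiplies \<open>\<bar>m (j - 1)\<bar>\<close> by \<open>j / (n - j)\<close> to give \<open>\<bar>m (j + 1)\<bar>\<close>, so the absolute
  values decrease in steps of two up to the middle and increase afterwards. It is therefore enough
  to bound them next to the two ends: \<open>m 1\<close> and \<open>m (n - 1)\<close> vanish, and \<open>m 2\<close> and \<open>m (n - 2)\<close> are
  obtained from \<open>m 0\<close> and \<open>m n\<close> on division by \<open>n - 1\<close>.\<close>

lemma recurrence_bound:
  fixes m :: "nat \<Rightarrow> real"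
  assumes rec: "\<And>j. j \<le> n \<Longrightarrow> real j * m (j - 1) + (real n - real j) * m (Suc j) = 0"
    and top: "\<bar>m n\<bar> \<le> m 0" and j: "1 \<le> j" "j < n"
  shows "\<bar>m j\<bar> \<le> m 0 / (real n - 1)"
proof -
  define B where "B = m 0 / (real n - 1)"
  have n: "n \<ge> 2" using j by linarith
  have B0: "B \<ge> 0" unfolding B_def using top n by simp
  have ab: "real i * \<bar>m (i - 1)\<bar> = (real n - real i) * \<bar>m (Suc i)\<bar>" if "i \<le> n" for i
  proof -
    have "real i * m (i - 1) = - ((real n - real i) * m (Suc i))" using rec[OF that] by linarith
    then have "\<bar>real i * m (i - 1)\<bar> = \<bar>(real n - real i) * m (Suc i)\<bar>" by (metis abs_minus)
    then show ?thesis using that by (simp add: abs_mult)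
  qed
  have m1: "\<bar>m (Suc 0)\<bar> = 0" using ab[of 0] n by simp
  have m2: "\<bar>m 2\<bar> = B"
  proof -
    have "(real n - 1) * \<bar>m 2\<bar> = m 0"
      using ab[of 1] n top by (simp add: numeral_2_eq_2)
    then show ?thesis unfolding B_def using n by (simp add: field_simps)
  qed
  have m3: "\<bar>m (n - 1)\<bar> = 0" using ab[of n] n by simp
  have m4: "\<bar>m (n - 2)\<bar> \<le> B"
  proof -
    have "real (n - 1) * \<bar>m (n - 1 - 1)\<bar> = (real n - real (n - 1)) * \<bar>m (Suc (n - 1))\<bar>"
      by (rule ab) simp
    moreover have "n - 1 - 1 = n - 2" "Suc (n - 1) = n" using n by auto
    ultimately have "(real n - 1) * \<bar>m (n - 2)\<bar> \<le> m 0"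
      using n top by (simp add: of_nat_diff)
    then show ?thesis unfolding B_def using n by (simp add: field_simps)
  qed
  have up: "2 * i \<le> n + 2 \<Longrightarrow> 1 \<le> i \<Longrightarrow> i \<le> n \<Longrightarrow> \<bar>m i\<bar> \<le> B" for i
  proof (induction i rule: less_induct)
    case (less i)
    consider "i = 1" | "i = 2" | "i \<ge> 3" using less.prems by linarith
    then show ?case
    proof cases
      case 3
      define k where "k = i - 1"
      have k: "i = Suc k" "k \<ge> 2" "2 * k \<le> n" "k < n" using 3 less.prems by (auto simp: k_def)
      have "\<bar>m (k - 1)\<bar> \<le> B" by (rule less.IH) (use k in auto)
      have "real k * \<bar>m (Suc k)\<bar> \<le> (real n - real k) * \<bar>m (Suc k)\<bar>"
        using k by (intro mult_right_mono) auto
      also have "\<dots> = real k * \<bar>m (k - 1)\<bar>" using ab[of k] k by simp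
      finally have "\<bar>m (Suc k)\<bar> \<le> \<bar>m (k - 1)\<bar>" using k by simp
      with \<open>\<bar>m (k - 1)\<bar> \<le> B\<close> show ?thesis using k by simp
    qed (use m1 m2 B0 in auto)
  qed
  have down: "n \<le> 2 * i + 2 \<Longrightarrow> i < n \<Longrightarrow> \<bar>m i\<bar> \<le> B" for i
  proof (induction "n - i" arbitrary: i rule: less_induct)
    case less
    consider "i = n - 1" | "i = n - 2" | "i + 3 \<le> n" using less.prems by linarith
    then show ?case
    proof cases
      case 3
      have "\<bar>m (Suc (Suc i))\<bar> \<le> B" by (rule less.hyps) (use 3 less.prems in auto)
      have "real (Suc i) * \<bar>m i\<bar> = (real n - real (Suc i)) * \<bar>m (Suc (Suc i))\<bar>"
        using ab[of "Suc i"] 3 by simp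
      also have "\<dots> \<le> real (Suc i) * \<bar>m (Suc (Suc i))\<bar>"
        using less.prems by (intro mult_right_mono) auto
      finally have "\<bar>m i\<bar> \<le> \<bar>m (Suc (Suc i))\<bar>" by (simp del: of_nat_Suc)
      with \<open>\<bar>m (Suc (Suc i))\<bar> \<le> B\<close> show ?thesis by simp
    qed (use m3 m4 B0 in auto)
  qed
  have "2 * j \<le> n + 2 \<or> n \<le> 2 * j + 2" by linarith
  then show ?thesis using up down j unfolding B_def by auto
qed

lemma halves_sum_bound:
  assumes "finite X" "V \<subseteq> X" "V \<noteq> {}" "V \<noteq> X"
  shows "\<bar>halves_sum X V\<bar> \<le> halves_sum X {} / (real (card X) - 1)"
proof -
  obtain m where m: "\<And>V. V \<subseteq> X \<Longrightarrow> halves_sum X V = m (card V)"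
    and rec: "\<And>j. j \<le> card X \<Longrightarrow> real j * m (j - 1) + (real (card X) - real j) * m (Suc j) = 0"
    using halves_sum_profile[OF assms(1)] by metis
  have "finite V" using assms finite_subset by blast
  have "\<bar>m (card X)\<bar> \<le> m 0"
    using abs_halves_sum_le[of X X] m[of X] m[of "{}"] by simp
  moreover have "1 \<le> card V" using assms \<open>finite V\<close> by (simp add: Suc_le_eq card_gt_0_iff)
  moreover have "card V < card X" using assms by (simp add: psubset_card_mono psubset_eq)
  ultimately show ?thesis
    using recurrence_bound[OF rec, of "card V"] m[of V] m[of "{}"] assms by simp
qed

text \<open>Here the preceding bound is attained, and the sum is negative.\<close>

lemma halves_sum_card_2:
  assumes "finite X" "V \<subseteq> X" "card V = 2"
  shows "halves_sum X V = - halves_sum X {} / (real (card X) - 1)"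
proof -
  obtain m where m: "\<And>V. V \<subseteq> X \<Longrightarrow> halves_sum X V = m (card V)"
    and rec: "\<And>j. j \<le> card X \<Longrightarrow> real j * m (j - 1) + (real (card X) - real j) * m (Suc j) = 0"
    using halves_sum_profile[OF assms(1)] by metis
  have "2 \<le> card X" using card_mono[OF assms(1,2)] assms(3) by simp
  with rec[of 1] have "m 0 + (real (card X) - 1) * m 2 = 0" by (simp add: numeral_2_eq_2)
  then show ?thesis using m[OF assms(2)] m[of "{}"] assms(3) \<open>2 \<le> card X\<close>
    by (simp add: field_simps)
qed

section \<open>The weight function of an ideal code of distance four\<close>

text \<open>The first factor selects the sets of even size. The second one adds to the trivial
  character a normalised character sum over the words of middle weight in length \<open>card B + 1\<close>; the
  auxiliary coordinate \<open>None\<close> makes this length even, and restricting to sets that avoid it produces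
  in length \<open>card B\<close> the words of the two middle weights together. With the multiplier \<open>card B\<close>
  the weight vanishes on sets of size two; since these minimise the normalised sum, by
  \<open>halves_sum_bound\<close> and \<open>halves_sum_card_2\<close>, the weight is nonnegative.\<close>

definition code_weight :: "'a set \<Rightarrow> 'a set \<Rightarrow> real" where
  "code_weight B V = (1 + (- 1) ^ card V) / (2 * (real (card B) + 1)) *
     (1 + real (card B) * halves_sum (insert None (Some ` B)) (Some ` V)
        / halves_sum (insert None (Some ` B)) {})"

lemma code_weight_empty:
  assumes "finite B" "odd (card B)"
  shows "code_weight B {} = 1"
  using halves_sum_empty_pos[of "insert None (Some ` B)"] assms
  by (simp add: code_weight_def card_image field_simps)

lemma code_weight_nonneg:
  assumes "finite B" "odd (card B)" "V \<subseteq> B"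
  shows "code_weight B V \<ge> 0"
proof (cases "V = {}")
  case True
  then show ?thesis using code_weight_empty[OF assms(1,2)] by simp
next
  case False
  define X where "X = insert None (Some ` B)"
  have X: "finite X" "card X = Suc (card B)" "even (card X)"
    using assms by (simp_all add: X_def card_image)
  have pos: "halves_sum X {} > 0" using halves_sum_empty_pos X by blast
  have "card B > 0" using assms(2) by (cases "card B") auto
  have "\<bar>halves_sum X (Some ` V)\<bar> \<le> halves_sum X {} / (real (card X) - 1)"
    by (rule halves_sum_bound) (use X(1) assms False in \<open>auto simp: X_def\<close>)
  then have "real (card B) * \<bar>halves_sum X (Some ` V)\<bar> \<le> halves_sum X {}"
    using X \<open>card B > 0\<close> by (simp add: field_simps)
  moreover have "- (real (card B) * \<bar>halves_sum X (Some ` V)\<bar>) \<le> real (card B) * halves_sum X (Some ` V)"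
    by (metis abs_ge_minus_self abs_mult abs_of_nat minus_le_iff)
  ultimately have "- halves_sum X {} \<le> real (card B) * halves_sum X (Some ` V)" by linarith
  then have "0 \<le> 1 + real (card B) * halves_sum X (Some ` V) / halves_sum X {}"
    using pos by (simp add: field_simps)
  moreover have "(0::real) \<le> 1 + (- 1) ^ card V"
    by (cases "even (card V)") auto
  ultimately show ?thesis
    unfolding code_weight_def X_def[symmetric] by (intro mult_nonneg_nonneg divide_nonneg_nonneg) auto
qed

lemma code_weight_eq_0:
  assumes "finite B" "odd (card B)" "V \<subseteq> B" "V \<noteq> {}" "card V < 4"
  shows "code_weight B V = 0"
proof (cases "odd (card V)")
  case True
  then show ?thesis by (simp add: code_weight_def)
next
  case False
  have "finite V" using assms finite_subset by blast
  with assms have "card V \<noteq> 0" by simp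
  moreover from False have "card V \<noteq> 1" "card V \<noteq> 3" by auto
  ultimately have c2: "card V = 2" using assms(5) by linarith
  define X where "X = insert None (Some ` B)"
  have X: "finite X" "card X = Suc (card B)" "even (card X)"
    using assms by (simp_all add: X_def card_image)
  have pos: "halves_sum X {} > 0" using halves_sum_empty_pos X by blast
  have "card B > 0" using assms(2) by (cases "card B") auto
  have "halves_sum X (Some ` V) = - halves_sum X {} / (real (card X) - 1)"
    by (rule halves_sum_card_2) (use X(1) assms c2 in \<open>auto simp: X_def card_image\<close>)
  then have "1 + real (card B) * halves_sum X (Some ` V) / halves_sum X {} = 0"
    using pos X \<open>card B > 0\<close> by (simp add: field_simps)
  then show ?thesis
    unfolding code_weight_def X_def[symmetric] by simp
qed

lemma sum_Pow_prod:
  fixes e :: "'a \<Rightarrow> real"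
  assumes "finite B"
  shows "(\<Sum>V\<in>Pow B. \<Prod>i\<in>V. e i) = (\<Prod>i\<in>B. 1 + e i)"
  using prod_add[OF assms, of e "\<lambda>_. 1"] by (simp add: add.commute)

text \<open>Each of the terms into which the product of the two factors expands is a character, and the sum
  over all \<open>V\<close> of a product of signs factorises over the coordinates.\<close>

lemma code_weight_transform:
  fixes e :: "'a \<Rightarrow> real"
  assumes "finite B"
  defines "X \<equiv> insert None (Some ` B)"
  shows "(\<Sum>V\<in>Pow B. code_weight B V * (\<Prod>i\<in>V. e i)) =
    ((\<Prod>i\<in>B. 1 + e i) + (\<Prod>i\<in>B. 1 - e i)
      + real (card B) / halves_sum X {} *
        (\<Sum>S\<in>halves X. (\<Prod>i\<in>B. 1 + set_sign S (Some i) * e i) + (\<Prod>i\<in>B. 1 - set_sign S (Some i) * e i)))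
      / (2 * (real (card B) + 1))"
proof -
  let ?p = "\<lambda>V. \<Prod>i\<in>V. e i"
  let ?m = "\<lambda>V. \<Prod>i\<in>V. - e i"
  let ?ps = "\<lambda>S V. \<Prod>i\<in>V. set_sign S (Some i) * e i"
  let ?ms = "\<lambda>S V. \<Prod>i\<in>V. - (set_sign S (Some i) * e i)"
  define c where "c = real (card B) / halves_sum X {}"
  have sgn: "(-1) ^ card V * (\<Prod>i\<in>V. f i) = (\<Prod>i\<in>V. - f i)" for V and f :: "'a \<Rightarrow> real"
    by (simp add: prod_uminus)
  have hs: "halves_sum X (Some ` V) = (\<Sum>S\<in>halves X. \<Prod>i\<in>V. set_sign S (Some i))" for V
    unfolding halves_sum_def by (simp add: prod.reindex)
  have summand: "code_weight B V * ?p V =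
    (?p V + ?m V + c * (\<Sum>S\<in>halves X. ?ps S V + ?ms S V)) / (2 * (real (card B) + 1))" for V
  proof -
    have "halves_sum X (Some ` V) * ?p V = (\<Sum>S\<in>halves X. ?ps S V)"
      by (simp add: hs sum_distrib_right prod.distrib)
    moreover have "(- 1) ^ card V * (\<Sum>S\<in>halves X. ?ps S V) = (\<Sum>S\<in>halves X. ?ms S V)"
      by (simp only: sum_distrib_left sgn)
    moreover have "code_weight B V * ?p V =
      ((?p V + (- 1) ^ card V * ?p V) + c * (halves_sum X (Some ` V) * ?p V + (- 1) ^ card V * (halves_sum X (Some ` V) * ?p V)))
        / (2 * (real (card B) + 1))"
      unfolding code_weight_def X_def[symmetric] c_def
      by (simp add: divide_simps) (simp add: algebra_simps)
    ultimately show ?thesis by (simp only: sgn sum.distrib)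
  qed
  have "(\<Sum>V\<in>Pow B. code_weight B V * ?p V) =
    ((\<Sum>V\<in>Pow B. ?p V) + (\<Sum>V\<in>Pow B. ?m V)
      + c * (\<Sum>S\<in>halves X. (\<Sum>V\<in>Pow B. ?ps S V) + (\<Sum>V\<in>Pow B. ?ms S V))) / (2 * (real (card B) + 1))"
    unfolding summand sum_divide_distrib[symmetric] sum.distrib sum_distrib_left[symmetric]
    by (simp add: sum.swap[of _ "Pow B"])
  then show ?thesis
    by (simp add: sum_Pow_prod[OF assms(1)] c_def)
qed

text \<open>All products in the preceding expansion have factors \<open>0\<close> or \<open>2\<close>; the first product comes from
  the trivial character.\<close>

lemma code_weight_transform_nonneg:
  fixes e :: "'a \<Rightarrow> real"
  assumes "finite B" and e: "\<And>i. i \<in> B \<Longrightarrow> \<bar>e i\<bar> = 1"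
  shows "(\<Sum>V\<in>Pow B. code_weight B V * (\<Prod>i\<in>V. e i)) \<ge> (\<Prod>i\<in>B. 1 + e i) / (2 * (real (card B) + 1))"
    and "(\<Sum>V\<in>Pow B. code_weight B V * (\<Prod>i\<in>V. e i)) \<ge> 0"
proof -
  have *: "(\<Prod>i\<in>B. 1 + f i) \<ge> 0" "(\<Prod>i\<in>B. 1 - f i) \<ge> 0" if "\<And>i. i \<in> B \<Longrightarrow> \<bar>f i\<bar> = 1" for f :: "'a \<Rightarrow> real"
    using that by (intro prod_nonneg; smt (verit))+
  have "(\<Prod>i\<in>B. 1 + set_sign S (Some i) * e i) \<ge> 0"
    "(\<Prod>i\<in>B. 1 - set_sign S (Some i) * e i) \<ge> 0" for S
    using e by (intro *; simp add: set_sign_def abs_mult)+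
  note ** = this
  have h: "halves_sum X {} \<ge> 0" for X :: "'a option set" by (simp add: halves_sum_empty)
  have q: "real (card B) / halves_sum (insert None (Some ` B)) {} * (\<Sum>S\<in>halves (insert None (Some ` B)). (\<Prod>i\<in>B. 1 + set_sign S (Some i) * e i) +
        (\<Prod>i\<in>B. 1 - set_sign S (Some i) * e i)) \<ge> 0"
    using h ** by (intro mult_nonneg_nonneg sum_nonneg add_nonneg_nonneg divide_nonneg_nonneg) auto
  show 1: "(\<Sum>V\<in>Pow B. code_weight B V * (\<Prod>i\<in>V. e i)) \<ge> (\<Prod>i\<in>B. 1 + e i) / (2 * (real (card B) + 1))"
    unfolding code_weight_transform[OF assms(1)]
    using q *(2)[OF e] by (intro divide_right_mono) auto
  have "(\<Prod>i\<in>B. 1 + e i) / (2 * (real (card B) + 1)) \<ge> 0"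
    using *(1)[OF e] by (intro divide_nonneg_nonneg) auto
  with 1 show "(\<Sum>V\<in>Pow B. code_weight B V * (\<Prod>i\<in>V. e i)) \<ge> 0" by linarith
qed

section \<open>Trigonometric kernels with nonnegative coefficients\<close>

text \<open>This is the binomial theorem for
  \<open>(1 + \<sigma> * cos t) / 2 = \<sigma> * cis (- t) * (1 + \<sigma> * cis t)\<^sup>2 / 4\<close>.\<close>

lemma cos_power_expansion:
  assumes "\<sigma> = 1 \<or> \<sigma> = (- 1 :: real)"
  shows "complex_of_real (((1 + \<sigma> * cos t) / 2) ^ N) =
    (\<Sum>p\<le>2 * N. of_real (real (2 * N choose p) / 4 ^ N * \<sigma> ^ (p + N)) * cis ((real p - real N) * t))"
proof -
  define z where "z = cis t"
  have z: "z * cis (- t) = 1" by (simp add: z_def cis_mult)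
  have s2: "\<sigma> * \<sigma> = 1" using assms by auto
  have "complex_of_real ((1 + \<sigma> * cos t) / 2) = (2 + \<sigma> * (z + cis (- t))) / 4"
    by (simp add: z_def complex_eq_iff)
  also have "\<dots> = \<sigma> * cis (- t) * (of_real \<sigma> * z + 1) ^ 2 / 4"
  proof -
    have "of_real \<sigma> * cis (- t) * (of_real \<sigma> * z + 1) ^ 2
      = of_real (\<sigma> * \<sigma>) * of_real \<sigma> * z * (z * cis (- t)) + 2 * of_real (\<sigma> * \<sigma>) * (z * cis (- t)) + of_real \<sigma> * cis (- t)"
      by (simp add: power2_eq_square algebra_simps)
    then show ?thesis by (simp add: z s2 algebra_simps)
  qed
  finally have "complex_of_real (((1 + \<sigma> * cos t) / 2) ^ N)
      = (\<sigma> * cis (- t) * (of_real \<sigma> * z + 1) ^ 2 / 4) ^ N"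
    by (simp only: of_real_power)
  also have "\<dots> = of_real (\<sigma> ^ N / 4 ^ N) * cis (- (real N * t)) * (of_real \<sigma> * z + 1) ^ (2 * N)"
    by (simp add: power_mult_distrib power_divide Complex.DeMoivre power_mult)
  also have "\<dots> = (\<Sum>p\<le>2 * N. of_real (\<sigma> ^ N / 4 ^ N) * cis (- (real N * t)) * (of_nat (2 * N choose p) * (of_real \<sigma> * z) ^ p))"
    by (simp add: binomial_ring sum_distrib_left)
  also have "\<dots> = (\<Sum>p\<le>2 * N. of_real (real (2 * N choose p) / 4 ^ N * \<sigma> ^ (p + N)) * cis ((real p - real N) * t))"
  proof (rule sum.cong[OF refl])
    fix p
    have "cis (- (real N * t)) * z ^ p = cis ((real p - real N) * t)"
      by (simp add: z_def Complex.DeMoivre cis_mult algebra_simps)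
    then show "of_real (\<sigma> ^ N / 4 ^ N) * cis (- (real N * t)) * (of_nat (2 * N choose p) * (of_real \<sigma> * z) ^ p)
      = of_real (real (2 * N choose p) / 4 ^ N * \<sigma> ^ (p + N)) * cis ((real p - real N) * t)"
      by (simp add: power_mult_distrib power_add flip: \<open>_ = cis ((real p - real N) * t)\<close>)
  qed
  finally show ?thesis .
qed

text \<open>A function of period \<open>2 * s\<close> in each coordinate, with values in \<open>[0, 1]\<close>, that takes the value \<open>1\<close>
  exactly at the points of \<open>s\<close> times the integer lattice whose set of odd coordinates is \<open>V\<close>.
  Its powers concentrate at these points.\<close>

definition bump :: "real \<Rightarrow> 'a::euclidean_space set \<Rightarrow> 'a \<Rightarrow> real" where
  "bump s V x = (\<Prod>b\<in>Basis. (1 + set_sign V b * cos (pi * (x \<bullet> b) / s)) / 2)"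

definition code_kernel :: "real \<Rightarrow> nat \<Rightarrow> 'a::euclidean_space \<Rightarrow> real" where
  "code_kernel s N x = (\<Sum>V\<in>Pow Basis. code_weight Basis V * bump s V x ^ N)"

text \<open>The index \<open>N\<close> in a coordinate stands for frequency zero there, because the exponents
  of the expansion in one variable are shifted by \<open>N\<close>. Accordingly \<open>frequency\<close> is centred at \<open>N\<close>; its
  sign is the one that turns \<open>cis\<close> into the exponential in the definition of \<open>fourier\<close>.\<close>

definition multi_indices :: "nat \<Rightarrow> ('a::euclidean_space \<Rightarrow> nat) set" where
  "multi_indices N = (Basis \<rightarrow>\<^sub>E {..2 * N})"

definition frequency :: "real \<Rightarrow> nat \<Rightarrow> ('a::euclidean_space \<Rightarrow> nat) \<Rightarrow> 'a" where
  "frequency s N g = (\<Sum>b\<in>Basis. ((real N - real (g b)) / (2 * s)) *\<^sub>R b)"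

definition binomial_coeff :: "nat \<Rightarrow> ('a::euclidean_space \<Rightarrow> nat) \<Rightarrow> real" where
  "binomial_coeff N g = (\<Prod>b\<in>Basis. real (2 * N choose g b) / 4 ^ N)"

definition code_coeff :: "nat \<Rightarrow> ('a::euclidean_space \<Rightarrow> nat) \<Rightarrow> real" where
  "code_coeff N g = (\<Sum>V\<in>Pow Basis. code_weight Basis V * (\<Prod>b\<in>V. (- 1) ^ (g b + N)))"

lemma finite_multi_indices: "finite (multi_indices N)"
  unfolding multi_indices_def by (rule finite_PiE) auto

lemma exp_frequency:
  fixes x :: "'a::euclidean_space"
  assumes "s > 0"
  shows "exp (- 2 * complex_of_real pi * \<i> * complex_of_real (x \<bullet> frequency s N g))
    = (\<Prod>b\<in>Basis. cis ((real (g b) - real N) * (pi * (x \<bullet> b) / s)))"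
proof -
  have "- 2 * complex_of_real pi * \<i> * complex_of_real (x \<bullet> frequency s N g)
    = (\<Sum>b\<in>Basis. - 2 * complex_of_real pi * \<i> * complex_of_real ((real N - real (g b)) / (2 * s) * (x \<bullet> b)))"
    by (simp add: frequency_def inner_sum_right sum_distrib_left)
  also have "\<dots> = (\<Sum>b\<in>Basis. \<i> * complex_of_real ((real (g b) - real N) * (pi * (x \<bullet> b) / s)))"
    using assms by (intro sum.cong refl) (simp add: field_simps)
  finally show ?thesis by (simp add: exp_sum cis_conv_exp)
qed

lemma bump_power_expansion:
  fixes x :: "'a::euclidean_space"
  assumes "s > 0" "V \<subseteq> Basis"
  shows "complex_of_real (bump s V x ^ N) =
    (\<Sum>g\<in>multi_indices N. of_real (binomial_coeff N g * (\<Prod>b\<in>V. (- 1) ^ (g b + N))) *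
       exp (- 2 * complex_of_real pi * \<i> * complex_of_real (x \<bullet> frequency s N g)))"
proof -
  have "complex_of_real (bump s V x ^ N)
    = (\<Prod>b\<in>Basis. complex_of_real (((1 + set_sign V b * cos (pi * (x \<bullet> b) / s)) / 2) ^ N))"
    by (simp add: bump_def prod_power_distrib)
  also have "\<dots> = (\<Prod>b\<in>Basis. \<Sum>p\<le>2 * N. of_real (real (2 * N choose p) / 4 ^ N * set_sign V b ^ (p + N))
      * cis ((real p - real N) * (pi * (x \<bullet> b) / s)))"
    by (intro prod.cong refl cos_power_expansion) (auto simp: set_sign_def)
  also have "\<dots> = (\<Sum>g\<in>multi_indices N. \<Prod>b\<in>Basis. of_real (real (2 * N choose g b) / 4 ^ N * set_sign V b ^ (g b + N))
      * cis ((real (g b) - real N) * (pi * (x \<bullet> b) / s)))"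
    unfolding multi_indices_def by (rule prod_sum_PiE) auto
  also have "\<dots> = (\<Sum>g\<in>multi_indices N. of_real (binomial_coeff N g * (\<Prod>b\<in>V. (- 1) ^ (g b + N))) *
       exp (- 2 * complex_of_real pi * \<i> * complex_of_real (x \<bullet> frequency s N g)))"
  proof (rule sum.cong[OF refl])
    fix g :: "'a \<Rightarrow> nat"
    have "(\<Prod>b\<in>V. (- 1) ^ (g b + N)) = (\<Prod>b\<in>V. set_sign V b ^ (g b + N))"
      by (intro prod.cong refl) (simp add: set_sign_def)
    also have "\<dots> = (\<Prod>b\<in>Basis. set_sign V b ^ (g b + N))"
      using assms(2) by (intro prod.mono_neutral_left) (auto simp: set_sign_def)
    finally have *: "(\<Prod>b\<in>V. (- 1) ^ (g b + N)) = (\<Prod>b\<in>Basis. set_sign V b ^ (g b + N))" .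
    show "(\<Prod>b\<in>Basis. of_real (real (2 * N choose g b) / 4 ^ N * set_sign V b ^ (g b + N))
        * cis ((real (g b) - real N) * (pi * (x \<bullet> b) / s)))
      = of_real (binomial_coeff N g * (\<Prod>b\<in>V. (- 1) ^ (g b + N))) *
       exp (- 2 * complex_of_real pi * \<i> * complex_of_real (x \<bullet> frequency s N g))"
      unfolding exp_frequency[OF assms(1)] * binomial_coeff_def prod.distrib[symmetric] of_real_prod
      by simp
  qed
  finally show ?thesis .
qed

text \<open>Shifting a bump to the vertex \<open>V\<close> only multiplies its coefficients by a character evaluated at
  \<open>V\<close>, so the coefficients of the kernel split into a binomial part and a transform of \<open>code_weight\<close>.\<close>

lemma code_kernel_expansion:
  fixes x :: "'a::euclidean_space"
  assumes "s > 0"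
  shows "complex_of_real (code_kernel s N x) =
    (\<Sum>g\<in>multi_indices N. of_real (binomial_coeff N g * code_coeff N g) *
       exp (- 2 * complex_of_real pi * \<i> * complex_of_real (x \<bullet> frequency s N g)))"
proof -
  let ?E = "\<lambda>g. exp (- 2 * complex_of_real pi * \<i> * complex_of_real (x \<bullet> frequency s N g))"
  have "complex_of_real (code_kernel s N x) = (\<Sum>V\<in>Pow Basis. of_real (code_weight Basis V) * complex_of_real (bump s V x ^ N))"
    by (simp add: code_kernel_def)
  also have "\<dots> = (\<Sum>V\<in>Pow Basis. \<Sum>g\<in>multi_indices N. of_real (code_weight Basis V) *
      (of_real (binomial_coeff N g * (\<Prod>b\<in>V. (- 1) ^ (g b + N))) * ?E g))"
    using assms by (intro sum.cong refl) (simp only: bump_power_expansion sum_distrib_left Pow_iff)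
  also have "\<dots> = (\<Sum>g\<in>multi_indices N. \<Sum>V\<in>Pow Basis. of_real (code_weight Basis V) *
      (of_real (binomial_coeff N g * (\<Prod>b\<in>V. (- 1) ^ (g b + N))) * ?E g))"
    by (rule sum.swap)
  also have "\<dots> = (\<Sum>g\<in>multi_indices N. of_real (binomial_coeff N g * code_coeff N g) * ?E g)"
    by (intro sum.cong refl) (simp add: code_coeff_def sum_distrib_left sum_distrib_right mult_ac)
  finally show ?thesis .
qed

section \<open>The lower bound from the Fourier side\<close>

lemma fourier_integrable:
  fixes f :: "'a::euclidean_space \<Rightarrow> real"
  assumes "integrable lborel f"
  shows "integrable lborel (\<lambda>x. complex_of_real (f x) * exp (- 2 * complex_of_real pi * \<i> * complex_of_real (x \<bullet> y)))"
proof (rule Bochner_Integration.integrable_bound[OF assms])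
  have [measurable]: "f \<in> borel_measurable borel" using assms by auto
  show "(\<lambda>x. complex_of_real (f x) * exp (- 2 * complex_of_real pi * \<i> * complex_of_real (x \<bullet> y))) \<in> borel_measurable lborel"
    unfolding measurable_lborel1
    by (intro borel_measurable_times borel_measurable_of_real borel_measurable_continuous_onI
        continuous_intros) auto
  have "norm (exp (- 2 * complex_of_real pi * \<i> * complex_of_real (x \<bullet> y))) = 1" for x
    by simp
  then show "AE x in lborel. norm (complex_of_real (f x) * exp (- 2 * complex_of_real pi * \<i> * complex_of_real (x \<bullet> y))) \<le> norm (f x)"
    by (simp add: norm_mult)
qed

text \<open>The integral of a function that is not integrable is \<open>0\<close> by convention.\<close>

lemma integrable_of_fourier_0:
  fixes f :: "'a::euclidean_space \<Rightarrow> real"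
  assumes "fourier f 0 \<ge> 1"
  shows "integrable lborel f"
proof (rule ccontr)
  assume "\<not> integrable lborel f"
  then have "fourier f 0 = 0"
    by (simp add: fourier_def not_integrable_integral_eq)
  with assms show False by (simp add: less_eq_complex_def)
qed

text \<open>Integrating the expansion of the kernel against \<open>f\<close> gives a finite sum of values of \<open>fourier f\<close> with
  nonnegative coefficients. The bound keeps the term of frequency zero only.\<close>

lemma kernel_integral_lower_bound:
  fixes f :: "'a::euclidean_space \<Rightarrow> real"
  assumes s: "s > 0" and f: "fourier f 0 \<ge> 1" "\<And>y. fourier f y \<ge> 0"
  shows "integrable lborel (\<lambda>x. f x * code_kernel s N x)"
    and "(\<integral>x. f x * code_kernel s N x \<partial>lborel) \<ge>
      (real (2 * N choose N) / 4 ^ N) ^ DIM('a) * 2 ^ DIM('a) / (2 * (real DIM('a) + 1))"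
proof -
  let ?E = "\<lambda>g x. exp (- 2 * complex_of_real pi * \<i> * complex_of_real (x \<bullet> frequency s N g))"
  let ?c = "\<lambda>g. binomial_coeff N g * code_coeff N g"
  have int: "integrable lborel f" by (rule integrable_of_fourier_0[OF f(1)])
  have expand: "complex_of_real (f x * code_kernel s N x)
      = (\<Sum>g\<in>multi_indices N. of_real (?c g) * (complex_of_real (f x) * ?E g x))" for x
    unfolding of_real_mult[of "f x"] code_kernel_expansion[OF s] sum_distrib_left
    by (intro sum.cong refl) (simp only: mult_ac)
  have "integrable lborel (\<lambda>x. complex_of_real (f x * code_kernel s N x))"
    unfolding expand by (intro Bochner_Integration.integrable_sum integrable_mult_right fourier_integrable int)
  then show "integrable lborel (\<lambda>x. f x * code_kernel s N x)"
    by (simp only: complex_of_real_integrable_eq)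
  have "complex_of_real (\<integral>x. f x * code_kernel s N x \<partial>lborel) = (\<integral>x. complex_of_real (f x * code_kernel s N x) \<partial>lborel)"
    by (rule integral_complex_of_real[symmetric])
  also have "\<dots> = (\<Sum>g\<in>multi_indices N. of_real (?c g) * fourier f (frequency s N g))"
    unfolding expand fourier_def
    by (subst Bochner_Integration.integral_sum)
      (intro integrable_mult_right fourier_integrable int, simp only: integral_mult_right_zero)
  finally have "Re (complex_of_real (\<integral>x. f x * code_kernel s N x \<partial>lborel))
      = Re (\<Sum>g\<in>multi_indices N. of_real (?c g) * fourier f (frequency s N g))" by simp
  then have eq: "(\<integral>x. f x * code_kernel s N x \<partial>lborel) = (\<Sum>g\<in>multi_indices N. ?c g * Re (fourier f (frequency s N g)))"
    by simp
  have bc: "binomial_coeff N g \<ge> 0" for g :: "'a \<Rightarrow> nat"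
    unfolding binomial_coeff_def by (intro prod_nonneg) simp
  have cc: "code_coeff N g \<ge> 0" for g :: "'a \<Rightarrow> nat"
    unfolding code_coeff_def by (rule code_weight_transform_nonneg(2)) (auto simp: power_abs)
  have Re: "Re (fourier f y) \<ge> 0" for y using f(2)[of y] by (simp add: less_eq_complex_def)
  \<comment> \<open>The multi-index of frequency zero. Its sign pattern is trivial because \<open>(- 1) ^ (N + N) = 1\<close>.\<close>
  define g0 :: "'a \<Rightarrow> nat" where "g0 = (\<lambda>b\<in>Basis. N)"
  have g0: "g0 \<in> multi_indices N" by (simp add: g0_def multi_indices_def)
  have freq0: "frequency s N g0 = 0" by (simp add: frequency_def g0_def)
  have bc0: "binomial_coeff N g0 = (real (2 * N choose N) / 4 ^ N) ^ DIM('a)"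
    by (simp add: binomial_coeff_def g0_def)
  have "code_coeff N g0 \<ge> (\<Prod>b\<in>(Basis::'a set). 1 + (- 1) ^ (g0 b + N)) / (2 * (real DIM('a) + 1))"
    unfolding code_coeff_def by (rule code_weight_transform_nonneg(1)) (auto simp: power_abs)
  also have "(\<Prod>b\<in>(Basis::'a set). 1 + (- 1) ^ (g0 b + N)) = (2 ^ DIM('a) :: real)"
    by (simp add: g0_def flip: mult_2)
  finally have cc0: "code_coeff N g0 \<ge> 2 ^ DIM('a) / (2 * (real DIM('a) + 1))" .
  have Re0: "Re (fourier f 0) \<ge> 1" using f(1) by (simp add: less_eq_complex_def)
  have "(real (2 * N choose N) / 4 ^ N) ^ DIM('a) * (2 ^ DIM('a) / (2 * (real DIM('a) + 1))) * 1
      \<le> ?c g0 * Re (fourier f (frequency s N g0))"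
    unfolding bc0 freq0 using cc0 Re0 cc[of g0] by (intro mult_mono mult_nonneg_nonneg) auto
  also have "\<dots> \<le> (\<Sum>g\<in>multi_indices N. ?c g * Re (fourier f (frequency s N g)))"
    by (rule member_le_sum[OF g0]) (auto intro!: mult_nonneg_nonneg bc cc Re finite_multi_indices)
  finally show "(\<integral>x. f x * code_kernel s N x \<partial>lborel) \<ge>
      (real (2 * N choose N) / 4 ^ N) ^ DIM('a) * 2 ^ DIM('a) / (2 * (real DIM('a) + 1))"
    unfolding eq by simp
qed

section \<open>The upper bound from the concentration of the kernel\<close>

lemma signed_cos_bounds:
  "0 \<le> (1 + set_sign V b * cos u) / 2" "(1 + set_sign V b * cos u) / 2 \<le> 1"
proof -
  have "- 1 \<le> set_sign V b * cos u \<and> set_sign V b * cos u \<le> 1"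
    using cos_ge_minus_one[of u] by (cases "b \<in> V") (simp_all add: set_sign_def)
  then show "0 \<le> (1 + set_sign V b * cos u) / 2" "(1 + set_sign V b * cos u) / 2 \<le> 1"
    by (simp_all; linarith)+
qed

lemma bump_nonneg: "bump s V x \<ge> 0"
  unfolding bump_def by (intro prod_nonneg ballI signed_cos_bounds)

text \<open>This is the minimal distance of Construction A. If the value were \<open>1\<close>, then \<open>x\<close> would be a lattice
  point with set of odd coordinates \<open>V\<close>. With at least four odd coordinates its norm is at least
  \<open>sqrt (4 * s\<^sup>2) = 2 * s\<close>, and with none it has a nonzero coordinate that is an even multiple of \<open>s\<close>.\<close>

lemma bump_less_1:
  fixes x :: "'a::euclidean_space"
  assumes s: "s > 0" and x: "norm x < 2 * s" and V: "V \<subseteq> Basis" "V = {} \<or> card V \<ge> 4"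
    and ne: "V \<noteq> {} \<or> x \<noteq> 0"
  shows "bump s V x < 1"
proof -
  let ?t = "\<lambda>b. (1 + set_sign V b * cos (pi * (x \<bullet> b) / s)) / 2"
  have t: "0 \<le> ?t b" "?t b \<le> 1" for b
    by (rule signed_cos_bounds)+
  have "\<exists>b\<in>Basis. ?t b \<noteq> 1"
  proof (rule ccontr)
    assume "\<not> (\<exists>b\<in>Basis. ?t b \<noteq> 1)"
    then have one: "set_sign V b * cos (pi * (x \<bullet> b) / s) = 1" if "b \<in> Basis" for b
      using that by fastforce
    show False
    proof (cases "V = {}")
      case True
      with ne obtain b where b: "b \<in> Basis" "x \<bullet> b \<noteq> 0"
        by (metis euclidean_all_zero_iff)
      have "cos (pi * (x \<bullet> b) / s) = 1" using one[OF b(1)] True by (simp add: set_sign_def)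
      then obtain n :: int where "pi * (x \<bullet> b) / s = of_int n * 2 * pi"
        by (auto simp: cos_one_2pi_int)
      then have n: "x \<bullet> b = of_int n * 2 * s" using s by (simp add: field_simps)
      with b have "n \<noteq> 0" by auto
      then have "1 \<le> \<bar>real_of_int n\<bar>" by linarith
      then have "2 * s \<le> \<bar>x \<bullet> b\<bar>" unfolding n using s by (simp add: abs_mult)
      with Basis_le_norm[OF b(1), of x] x show False by simp
    next
      case False
      with V have card: "card V \<ge> 4" by simp
      have "s\<^sup>2 \<le> (x \<bullet> b) * (x \<bullet> b)" if "b \<in> V" for b
      proof -
        have "cos (pi * (x \<bullet> b) / s) = - 1" using one[of b] that V by (auto simp: set_sign_def)
        then obtain n :: int where "pi * (x \<bullet> b) / s = (2 * of_int n + 1) * pi"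
          by (auto simp: cos_eq_minus1)
        then have "pi * ((x \<bullet> b) / s) = pi * (2 * of_int n + 1)" by (simp add: mult.commute)
        then have "(x \<bullet> b) / s = 2 * of_int n + 1" by (simp only: mult_cancel_left pi_neq_zero simp_thms)
        then have n: "x \<bullet> b = (2 * of_int n + 1) * s" using s by (simp add: field_simps)
        have "1 \<le> \<bar>2 * n + 1\<bar>" by presburger
        then have "1 \<le> \<bar>2 * real_of_int n + 1\<bar>" by linarith
        then have "s \<le> \<bar>x \<bullet> b\<bar>" unfolding n using s by (simp add: abs_mult)
        then have "s * s \<le> \<bar>x \<bullet> b\<bar> * \<bar>x \<bullet> b\<bar>" using s by (intro mult_mono) auto
        then show ?thesis by (simp add: power2_eq_square)
      qed
      then have "real (card V) * s\<^sup>2 \<le> (\<Sum>b\<in>V. (x \<bullet> b) * (x \<bullet> b))"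
        by (rule sum_bounded_below)
      also have "\<dots> \<le> (\<Sum>b\<in>Basis. (x \<bullet> b) * (x \<bullet> b))"
        by (rule sum_mono2) (use V in auto)
      also have "\<dots> = (norm x)\<^sup>2"
        by (simp add: euclidean_inner[symmetric] power2_norm_eq_inner)
      also have "\<dots> < (2 * s)\<^sup>2" by (rule power_strict_mono) (use x in auto)
      finally have "real (card V) * s\<^sup>2 < 4 * s\<^sup>2" by (simp add: power_mult_distrib)
      with s card show False by simp
    qed
  qed
  then obtain b where b: "b \<in> Basis" "?t b < 1" using t by (metis order_less_le)
  have "bump s V x = ?t b * (\<Prod>c\<in>Basis - {b}. ?t c)"
    unfolding bump_def by (rule prod.remove) (use b in auto)
  also have "\<dots> \<le> ?t b * 1"
    using t by (intro mult_left_mono prod_le_1) auto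
  finally show ?thesis using b by simp
qed

lemma continuous_on_bump: "continuous_on A (bump s V)"
  unfolding bump_def by (cases "s = 0") (auto intro!: continuous_intros)

text \<open>By compactness the strict inequality becomes uniform on the closed ball of radius \<open>r\<close>; the excluded
  part is the neighbourhood of the origin, where the bump with \<open>V = {}\<close> has its peak.\<close>

lemma bump_uniform_bound:
  assumes s: "s > 0" "0 < r" "r < 2 * s" and d: "\<delta> > 0" and odd: "odd DIM('a::euclidean_space)"
  obtains q where "0 \<le> q" "q < 1"
    "\<And>V x :: 'a. V \<subseteq> Basis \<Longrightarrow> code_weight Basis V \<noteq> 0 \<Longrightarrow> norm x \<le> r \<Longrightarrow> V \<noteq> {} \<or> norm x \<ge> \<delta> \<Longrightarrow> bump s V x \<le> q"
proof -
  define K :: "'a set \<Rightarrow> 'a set" where "K V = {x. norm x \<le> r \<and> (V \<noteq> {} \<or> norm x \<ge> \<delta>)}" for V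
  have compK: "compact (K V)" for V
  proof -
    have "closed {x :: 'a. \<delta> \<le> norm x}" by (intro closed_Collect_le continuous_intros)
    moreover have "K V = cball 0 r \<inter> (if V \<noteq> {} then UNIV else {x. \<delta> \<le> norm x})"
      by (auto simp: K_def)
    ultimately show ?thesis by (auto intro!: compact_Int_closed)
  qed
  have "\<exists>q<1. \<forall>x\<in>K V. bump s V x \<le> q" if V: "V \<in> {V. V \<subseteq> Basis \<and> code_weight Basis V \<noteq> 0}" for V :: "'a set"
  proof (cases "K V = {}")
    case True
    then show ?thesis by (intro exI[of _ 0]) auto
  next
    case False
    then obtain x where x: "x \<in> K V" "\<And>y. y \<in> K V \<Longrightarrow> bump s V y \<le> bump s V x"
      using continuous_attains_sup[OF compK _ continuous_on_bump] by metis
    have "V = {} \<or> card V \<ge> 4"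
      using code_weight_eq_0[of Basis V] V odd finite_Basis not_less by blast
    then have "bump s V x < 1" using x(1) V s d by (intro bump_less_1) (auto simp: K_def)
    with x show ?thesis by auto
  qed
  then obtain Q where Q: "\<And>V. V \<in> {V. V \<subseteq> Basis \<and> code_weight Basis V \<noteq> 0} \<Longrightarrow> Q V < 1 \<and> (\<forall>x\<in>K V. bump s V x \<le> Q V)"
    by metis
  let ?S = "insert 0 (Q ` {V. V \<subseteq> Basis \<and> code_weight Basis V \<noteq> 0})"
  have fin: "finite ?S" by (auto intro: finite_subset[of _ "Pow Basis"])
  show ?thesis
  proof (rule that[of "Max ?S"])
    show "0 \<le> Max ?S" using fin by (intro Max_ge) auto
    show "Max ?S < 1" using fin Q by (subst Max_less_iff) auto
    fix V :: "'a set" and x :: 'a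
    assume *: "V \<subseteq> Basis" "code_weight Basis V \<noteq> 0" "norm x \<le> r" "V \<noteq> {} \<or> norm x \<ge> \<delta>"
    then have "bump s V x \<le> Q V" using Q[of V] by (auto simp: K_def)
    also have "\<dots> \<le> Max ?S" using fin * by (intro Max_ge) auto
    finally show "bump s V x \<le> Max ?S" .
  qed
qed

text \<open>Over one period only the constant term of the cosine expansion contributes.\<close>

lemma nn_integral_cos_power:
  assumes s: "s > 0"
  shows "(\<integral>\<^sup>+t. ennreal (((1 + cos (pi * t / s)) / 2) ^ N * indicator {- s..s} t) \<partial>lborel)
    = ennreal (2 * s * (real (2 * N choose N) / 4 ^ N))"
proof -
  define k where "k t = ((1 + cos (pi * t / s)) / 2) ^ N" for t
  define c where "c p = real (2 * N choose p) / 4 ^ N" for p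
  define F where "F t = (\<Sum>p\<le>2 * N. c p * (if p = N then t else
    sin ((real p - real N) * (pi * t / s)) * (s / ((real p - real N) * pi))))" for t
  have k: "k t = (\<Sum>p\<le>2 * N. c p * cos ((real p - real N) * (pi * t / s)))" for t
  proof -
    have "k t = Re (complex_of_real (((1 + 1 * cos (pi * t / s)) / 2) ^ N))" 
      unfolding k_def by (simp only: Re_complex_of_real mult_1)
    also have "\<dots> = (\<Sum>p\<le>2 * N. c p * cos ((real p - real N) * (pi * t / s)))"
      by (subst cos_power_expansion) (simp_all add: c_def del: of_real_divide of_real_power)
    finally show ?thesis .
  qed
  have deriv: "(F has_real_derivative k t) (at t)" for t
    unfolding F_def k
  proof (intro DERIV_sum DERIV_cmult)
    fix p
    show "((\<lambda>t. if p = N then t else sin ((real p - real N) * (pi * t / s)) * (s / ((real p - real N) * pi)))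
      has_real_derivative cos ((real p - real N) * (pi * t / s))) (at t)"
    proof (cases "p = N")
      case True
      then show ?thesis by (auto intro!: derivative_eq_intros)
    next
      case False
      define a where "a = real p - real N"
      have a: "a * (pi / s) * (s / (a * pi)) = 1" using False s by (simp add: a_def)
      have "((\<lambda>t. sin (a * (pi * t / s)) * (s / (a * pi))) has_real_derivative
          cos (a * (pi * t / s)) * (a * (pi / s)) * (s / (a * pi))) (at t)"
        using s by (auto intro!: derivative_eq_intros)
      then have "((\<lambda>t. sin (a * (pi * t / s)) * (s / (a * pi))) has_real_derivative
          cos (a * (pi * t / s))) (at t)"
        by (simp only: mult.assoc[of "cos _"] a mult_1_right)
      with False show ?thesis by (simp add: a_def)
    qed
  qed
  have "(\<integral>\<^sup>+t. ennreal (k t) * indicator {- s..s} t \<partial>lborel) = ennreal (F s - F (- s))"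
  proof (rule nn_integral_FTC_Icc)
    show "k \<in> borel_measurable borel"
      unfolding k_def using s by (intro borel_measurable_continuous_onI continuous_intros) auto
    have "1 + cos (pi * t / s) \<ge> 0" for t using cos_ge_minus_one[of "pi * t / s"] by linarith
    then show "0 \<le> k t" for t by (simp add: k_def)
  qed (use s deriv in auto)
  also have "F s - F (- s) = (\<Sum>p\<le>2 * N. if p = N then 2 * s * c N else 0)"
    unfolding F_def sum_subtractf[symmetric]
  proof (rule sum.cong[OF refl])
    fix p
    have "sin ((real p - real N) * pi) = 0"
      using sin_npi_int[of "int p - int N"] by (simp add: mult.commute)
    then show "c p * (if p = N then s else sin ((real p - real N) * (pi * s / s)) * (s / ((real p - real N) * pi)))
      - c p * (if p = N then - s else sin ((real p - real N) * (pi * - s / s)) * (s / ((real p - real N) * pi)))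
      = (if p = N then 2 * s * c N else 0)"
      using s by simp
  qed
  also have "\<dots> = 2 * s * c N" by simp
  finally have "(\<integral>\<^sup>+t. ennreal (k t) * indicator {- s..s} t \<partial>lborel) = ennreal (2 * s * c N)" .
  moreover have "ennreal (k t * indicator {- s..s} t) = ennreal (k t) * indicator {- s..s} t" for t
    by (auto simp: indicator_def)
  ultimately show ?thesis by (simp add: k_def c_def)
qed

text \<open>The power of \<open>bump s {}\<close> cut off to the cell around the origin, written as a product
  of functions of one coordinate so that its integral factorises.\<close>

definition cell_bump :: "real \<Rightarrow> nat \<Rightarrow> 'a::euclidean_space \<Rightarrow> real" where
  "cell_bump s N x = (\<Prod>b\<in>Basis. ((1 + cos (pi * (x \<bullet> b) / s)) / 2) ^ N * indicator {- s..s} (x \<bullet> b))"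

lemma cell_bump_nonneg: "cell_bump s N x \<ge> 0"
proof -
  have "1 + cos (pi * t / s) \<ge> 0" for t using cos_ge_minus_one[of "pi * t / s"] by linarith
  then show ?thesis unfolding cell_bump_def by (intro prod_nonneg) auto
qed

lemma cell_bump_integral:
  assumes s: "s > 0"
  shows "integrable lborel (cell_bump s N :: 'a::euclidean_space \<Rightarrow> real)"
    and "(\<integral>x. cell_bump s N x \<partial>(lborel :: 'a measure)) = (2 * s * (real (2 * N choose N) / 4 ^ N)) ^ DIM('a)"
proof -
  define k where "k t = ((1 + cos (pi * t / s)) / 2) ^ N * indicator {- s..s} t" for t
  have [measurable]: "k \<in> borel_measurable borel"
    unfolding k_def using s
    by (intro borel_measurable_times borel_measurable_indicator borel_measurable_continuous_onI continuous_intros) auto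
  have "1 + cos (pi * t / s) \<ge> 0" for t using cos_ge_minus_one[of "pi * t / s"] by linarith
  then have k0: "k t \<ge> 0" for t by (simp add: k_def)
  have cb: "cell_bump s N x = (\<Prod>b\<in>Basis. k (x \<bullet> b))" for x :: 'a
    by (simp add: cell_bump_def k_def)
  have [measurable]: "(cell_bump s N :: 'a \<Rightarrow> real) \<in> borel_measurable borel"
    unfolding cb[abs_def] by measurable
  have "(\<integral>\<^sup>+x. ennreal (cell_bump s N x) \<partial>(lborel :: 'a measure)) = (\<integral>\<^sup>+x. (\<Prod>b\<in>Basis. ennreal (k (x \<bullet> b))) \<partial>(lborel :: 'a measure))"
    by (simp add: cb prod_ennreal k0)
  also have "\<dots> = (\<Prod>b\<in>(Basis :: 'a set). \<integral>\<^sup>+t. ennreal (k t) \<partial>lborel)"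
    by (rule nn_integral_lborel_prod) auto
  also have "\<dots> = ennreal ((2 * s * (real (2 * N choose N) / 4 ^ N)) ^ DIM('a))"
    using nn_integral_cos_power[OF s, of N] s by (simp add: k_def ennreal_power)
  finally have "integrable lborel (cell_bump s N :: 'a \<Rightarrow> real) \<and>
     (\<integral>x. cell_bump s N x \<partial>(lborel :: 'a measure)) = (2 * s * (real (2 * N choose N) / 4 ^ N)) ^ DIM('a)"
    using s cell_bump_nonneg by (subst (asm) nn_integral_eq_integrable) auto
  then show "integrable lborel (cell_bump s N :: 'a::euclidean_space \<Rightarrow> real)"
    and "(\<integral>x. cell_bump s N x \<partial>(lborel :: 'a measure)) = (2 * s * (real (2 * N choose N) / 4 ^ N)) ^ DIM('a)"
    by auto
qed

text \<open>Where \<open>f\<close> may be positive the kernel is, up to an error of order \<open>q ^ N\<close>, a single bump at the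
  origin, of weight \<open>code_weight Basis {} = 1\<close>, and close to the origin \<open>f\<close> is at most \<open>f 0 + \<epsilon>\<close>.\<close>

lemma kernel_integral_upper_bound:
  fixes f :: "'a::euclidean_space \<Rightarrow> real"
  assumes s: "0 < r" "r < 2 * s" and odd: "odd DIM('a)"
    and f: "continuous_on UNIV f" "f 0 > 0" "\<And>x. norm x \<ge> r \<Longrightarrow> f x \<le> 0"
    and int: "\<And>N. integrable lborel (\<lambda>x. f x * code_kernel s N x)" and \<epsilon>: "\<epsilon> > 0"
  obtains C q where "0 \<le> q" "q < 1" "0 \<le> C"
    "\<And>N. (\<integral>x. f x * code_kernel s N x \<partial>lborel) \<le>
      (f 0 + \<epsilon>) * (2 * s * (real (2 * N choose N) / 4 ^ N)) ^ DIM('a) + C * q ^ N"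
proof -
  have s0: "s > 0" using s by simp
  obtain \<delta>' where \<delta>': "\<delta>' > 0" "\<And>x. norm x < \<delta>' \<Longrightarrow> \<bar>f x - f 0\<bar> < \<epsilon>"
    using f(1) \<epsilon> unfolding continuous_on_iff dist_norm by (metis UNIV_I diff_zero real_norm_def)
  define \<delta> where "\<delta> = min \<delta>' s"
  have \<delta>: "\<delta> > 0" "\<delta> \<le> s" "\<And>x. norm x < \<delta> \<Longrightarrow> f x \<le> f 0 + \<epsilon>"
    using \<delta>' s0 by (auto simp: \<delta>_def) (smt (verit))
  have "compact (f ` cball 0 r)"
    by (intro compact_continuous_image continuous_on_subset[OF f(1)]) auto
  then obtain M' where M': "\<And>x. norm x \<le> r \<Longrightarrow> \<bar>f x\<bar> \<le> M'"
    by (force dest!: compact_imp_bounded simp: bounded_iff)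
  \<comment> \<open>The second argument of \<open>max\<close> lets the same constant absorb the error near the origin.\<close>
  define M where "M = max M' (f 0 + \<epsilon>)"
  have M: "f 0 + \<epsilon> \<le> M" "0 \<le> M" "f x \<le> M" if "norm x \<le> r" for x
    using M'[OF that] f(2) \<epsilon> by (auto simp: M_def)
  obtain q where q: "0 \<le> q" "q < 1"
    "\<And>V x :: 'a. V \<subseteq> Basis \<Longrightarrow> code_weight Basis V \<noteq> 0 \<Longrightarrow> norm x \<le> r \<Longrightarrow> V \<noteq> {} \<or> norm x \<ge> \<delta> \<Longrightarrow> bump s V x \<le> q"
    by (rule bump_uniform_bound[OF s0 s \<delta>(1) odd]) (rule that; blast)
  define A where "A = (\<Sum>V\<in>Pow (Basis :: 'a set). code_weight Basis V)"
  have cw: "code_weight Basis V \<ge> 0" if "V \<subseteq> Basis" for V :: "'a set"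
    using code_weight_nonneg[OF _ odd that] by simp
  have A: "A \<ge> 0" unfolding A_def using cw by (intro sum_nonneg) auto
  have ker0: "code_kernel s N x \<ge> 0" for N and x :: 'a
    unfolding code_kernel_def using cw by (intro sum_nonneg mult_nonneg_nonneg zero_le_power bump_nonneg) auto
  have summand: "code_weight Basis V * bump s V x ^ N \<le> code_weight Basis V * q ^ N"
    if "V \<subseteq> Basis" "norm x \<le> r" "V \<noteq> {} \<or> norm x \<ge> \<delta>" for V N and x :: 'a
  proof (cases "code_weight Basis V = 0")
    case False
    with that q(3) have "bump s V x \<le> q" by blast
    then show ?thesis using cw[OF that(1)] by (intro mult_left_mono power_mono bump_nonneg)
  qed simp
  have far: "code_kernel s N x \<le> A * q ^ N" if "norm x \<le> r" "norm x \<ge> \<delta>" for N and x :: 'a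
    unfolding code_kernel_def A_def sum_distrib_right using that summand by (intro sum_mono) auto
  have near: "code_kernel s N x \<le> bump s {} x ^ N + A * q ^ N" if "norm x \<le> r" for N and x :: 'a
  proof -
    have "code_kernel s N x = code_weight (Basis :: 'a set) {} * bump s {} x ^ N
        + (\<Sum>V\<in>Pow Basis - {{}}. code_weight Basis V * bump s V x ^ N)"
      unfolding code_kernel_def by (rule sum.remove) auto
    also have "code_weight (Basis :: 'a set) {} = 1"
      using code_weight_empty[of "Basis :: 'a set"] odd by simp
    also have "(\<Sum>V\<in>Pow Basis - {{}}. code_weight Basis V * bump s V x ^ N)
        \<le> (\<Sum>V\<in>Pow (Basis :: 'a set) - {{}}. code_weight Basis V * q ^ N)"
      using summand that by (intro sum_mono) auto
    also have "\<dots> \<le> A * q ^ N"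
      unfolding A_def sum_distrib_right using cw q by (intro sum_mono2) auto
    finally show ?thesis by simp
  qed
  have cell: "cell_bump s N x = bump s {} x ^ N" if "norm x < \<delta>" for N and x :: 'a
  proof -
    have "\<bar>x \<bullet> b\<bar> \<le> s" if "b \<in> Basis" for b
      using Basis_le_norm[OF that, of x] \<open>norm x < \<delta>\<close> \<delta>(2) by linarith
    then have "x \<bullet> b \<in> {- s..s}" if "b \<in> Basis" for b
      using that by (simp add: abs_le_iff) (metis minus_le_iff)
    then show ?thesis
      unfolding cell_bump_def bump_def prod_power_distrib by (intro prod.cong) (simp_all add: set_sign_def)
  qed
  have ptw: "f x * code_kernel s N x \<le> (f 0 + \<epsilon>) * cell_bump s N x + M * A * q ^ N * indicator (cball 0 r) x" for N x
  proof -
    have c0: "(f 0 + \<epsilon>) * cell_bump s N x \<ge> 0" 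
      using f(2) \<epsilon> by (intro mult_nonneg_nonneg cell_bump_nonneg) auto
    consider "norm x > r" | "norm x \<le> r" "norm x < \<delta>" | "norm x \<le> r" "norm x \<ge> \<delta>" by linarith
    then show ?thesis
    proof cases
      case 1
      then have "f x * code_kernel s N x \<le> 0"
        using f(3)[of x] ker0[of N x] by (simp add: mult_nonpos_nonneg)
      with c0 1 show ?thesis by simp
    next
      case 2
      have "f x * code_kernel s N x \<le> (f 0 + \<epsilon>) * (bump s {} x ^ N + A * q ^ N)"
        using \<delta>(3)[OF 2(2)] near[OF 2(1)] ker0 f(2) \<epsilon> by (intro mult_mono) auto
      also have "\<dots> \<le> (f 0 + \<epsilon>) * bump s {} x ^ N + M * (A * q ^ N)"
        unfolding distrib_left using M(1)[OF 2(1)] A q by (intro add_left_mono mult_right_mono) auto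
      finally show ?thesis using 2 cell[OF 2(2), of N] by (simp add: mult.assoc)
    next
      case 3
      have "f x * code_kernel s N x \<le> M * (A * q ^ N)"
        using M(2,3)[OF 3(1)] far[OF 3] ker0 by (intro mult_mono) auto
      with c0 3 show ?thesis by (simp add: mult.assoc)
    qed
  qed
  have M0: "M \<ge> 0" using M(2)[of 0] s by simp
  have ball: "integrable lborel (\<lambda>x::'a. indicator (cball 0 r) x :: real)"
    by (rule integrable_real_indicator) (simp_all add: emeasure_lborel_cball_finite[simplified])
  define C where "C = M * A * measure lborel (cball (0::'a) r)"
  show ?thesis
  proof (rule that[OF q(1,2)])
    show "0 \<le> C" using M0 A by (simp add: C_def)
    fix N
    have "(\<integral>x. f x * code_kernel s N x \<partial>lborel)
      \<le> (\<integral>x. (f 0 + \<epsilon>) * cell_bump s N x + M * A * q ^ N * indicator (cball 0 r) x \<partial>(lborel :: 'a measure))"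
    proof (rule Bochner_Integration.integral_mono[OF int _ ptw])
      show "integrable lborel (\<lambda>x::'a. (f 0 + \<epsilon>) * cell_bump s N x + M * A * q ^ N * indicator (cball 0 r) x)"
        using cell_bump_integral(1)[OF s0] ball
        by (intro Bochner_Integration.integrable_add integrable_mult_right)
    qed
    also have "\<dots> = (f 0 + \<epsilon>) * (2 * s * (real (2 * N choose N) / 4 ^ N)) ^ DIM('a) + C * q ^ N"
      using cell_bump_integral[OF s0, where 'a = 'a and N = N] ball
      by (subst Bochner_Integration.integral_add) (auto intro: integrable_mult_right simp: C_def)
    finally show "(\<integral>x. f x * code_kernel s N x \<partial>lborel) \<le>
      (f 0 + \<epsilon>) * (2 * s * (real (2 * N choose N) / 4 ^ N)) ^ DIM('a) + C * q ^ N" .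
  qed
qed

section \<open>Passage to the limit\<close>

lemma polynomial_times_geometric_tendsto_0:
  fixes q :: real
  assumes "0 \<le> q" "q < 1" "d > 0"
  shows "(\<lambda>N. real N ^ d * q ^ N) \<longlonglongrightarrow> 0"
proof -
  define p where "p = root d q"
  have p: "p ^ d = q" "0 \<le> p" "p < 1"
    using assms by (auto simp: p_def)
  have "(\<lambda>N. (real N * p ^ N) ^ d) \<longlonglongrightarrow> 0 ^ d"
    using p by (intro tendsto_power powser_times_n_limit_0) auto
  moreover have "(real N * p ^ N) ^ d = real N ^ d * q ^ N" for N
    unfolding p(1)[symmetric] by (simp add: power_mult_distrib power_commutes flip: power_mult) (simp add: mult.commute)
  ultimately show ?thesis using assms(3) by (simp only: zero_power)
qed

text \<open>Both bounds for the integral contain the factor \<open>w ^ d\<close>, where \<open>w\<close> is the central coefficient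
  of the one-variable kernel. As \<open>w\<close> decreases only polynomially in \<open>N\<close>, the error of order
  \<open>q ^ N\<close> stays negligible after division by \<open>w ^ d\<close>.\<close>

lemma admissible_bound_strict:
  fixes f :: "'a::euclidean_space \<Rightarrow> real"
  assumes s: "0 < r" "r < 2 * s" and odd: "odd DIM('a)"
    and f: "continuous_on UNIV f" "f 0 > 0" "\<And>x. norm x \<ge> r \<Longrightarrow> f x \<le> 0"
      "fourier f 0 \<ge> 1" "\<And>y. fourier f y \<ge> 0"
  shows "1 / (2 * (real DIM('a) + 1)) \<le> s ^ DIM('a) * f 0"
proof -
  let ?d = "DIM('a)"
  have s0: "s > 0" using s by simp
  have "1 / (2 * (real ?d + 1)) \<le> s ^ ?d * (f 0 + \<epsilon>)" if \<epsilon>: "\<epsilon> > 0" for \<epsilon>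
  proof -
    obtain C q where Cq: "0 \<le> q" "q < 1" "0 \<le> C"
      and up: "\<And>N. (\<integral>x. f x * code_kernel s N x \<partial>lborel) \<le>
        (f 0 + \<epsilon>) * (2 * s * (real (2 * N choose N) / 4 ^ N)) ^ ?d + C * q ^ N"
      by (rule kernel_integral_upper_bound[OF s odd f(1-3) kernel_integral_lower_bound(1)[OF s0 f(4,5)] \<epsilon>],
          assumption, (rule that; blast))
    have "2 ^ ?d / (2 * (real ?d + 1)) \<le> (f 0 + \<epsilon>) * (2 * s) ^ ?d + C * 2 ^ ?d * (real N ^ ?d * q ^ N)"
      if N: "N \<ge> 1" for N
    proof -
      define w where "w = real (2 * N choose N) / 4 ^ N"
      \<comment> \<open>The central coefficient is at least \<open>1 / (2 * N)\<close>.\<close>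
      have "4 ^ N / (2 * real N) \<le> real (2 * N choose N)"
        by (rule central_binomial_lower_bound) (use N in simp)
      then have w: "1 \<le> 2 * real N * w" using N by (simp add: w_def field_simps)
      have w0: "w > 0" by (simp add: w_def)
      have "w ^ ?d * (2 ^ ?d / (2 * (real ?d + 1))) \<le> (f 0 + \<epsilon>) * (2 * s * w) ^ ?d + C * q ^ N * 1"
        using kernel_integral_lower_bound(2)[OF s0 f(4,5), of N] up[of N] by (simp add: w_def)
      also have "\<dots> \<le> (f 0 + \<epsilon>) * (2 * s * w) ^ ?d + C * q ^ N * (2 * real N * w) ^ ?d"
        using w Cq by (intro add_left_mono mult_left_mono one_le_power) auto
      also have "\<dots> = w ^ ?d * ((f 0 + \<epsilon>) * (2 * s) ^ ?d + C * 2 ^ ?d * (real N ^ ?d * q ^ N))"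
        by (simp add: power_mult_distrib algebra_simps)
      finally show ?thesis by (simp only: mult_le_cancel_left_pos zero_less_power[OF w0])
    qed
    moreover have "(\<lambda>N. (f 0 + \<epsilon>) * (2 * s) ^ ?d + C * 2 ^ ?d * (real N ^ ?d * q ^ N))
        \<longlonglongrightarrow> (f 0 + \<epsilon>) * (2 * s) ^ ?d + C * 2 ^ ?d * 0"
      using Cq by (intro tendsto_intros polynomial_times_geometric_tendsto_0) auto
    ultimately have "2 ^ ?d / (2 * (real ?d + 1)) \<le> (f 0 + \<epsilon>) * (2 * s) ^ ?d + C * 2 ^ ?d * 0"
      by (intro LIMSEQ_le_const) auto
    then have "2 ^ ?d * (1 / (2 * (real ?d + 1))) \<le> 2 ^ ?d * (s ^ ?d * (f 0 + \<epsilon>))"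
      by (simp add: power_mult_distrib mult_ac)
    then show ?thesis by (simp only: mult_le_cancel_left_pos zero_less_power zero_less_numeral)
  qed
  then have "1 / (2 * (real ?d + 1)) \<le> s ^ ?d * f 0 + e" if "e > 0" for e
  proof -
    have "s ^ ?d * (f 0 + e / s ^ ?d) = s ^ ?d * f 0 + e" using s0 by (simp add: distrib_left)
    then show ?thesis using \<open>\<And>\<epsilon>. 0 < \<epsilon> \<Longrightarrow> _\<close>[of "e / s ^ ?d"] that s0 by simp
  qed
  then show ?thesis by (rule field_le_epsilon)
qed

lemma admissible_bound:
  fixes f :: "'a::euclidean_space \<Rightarrow> real"
  assumes r: "0 < r" and odd: "odd DIM('a)" and f: "cohn_elkies_admissible r f"
  shows "1 / (2 * (real DIM('a) + 1)) \<le> (r / 2) ^ DIM('a) * f 0"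
proof -
  have "times_cont_differentiable 0 f" 
    using f unfolding cohn_elkies_admissible_def smooth_def by blast
  then have cont: "continuous_on UNIV f" by simp
  have "1 / (2 * (real DIM('a) + 1)) \<le> s ^ DIM('a) * f 0" if "s > r / 2" for s
    using f that by (intro admissible_bound_strict[OF r _ odd cont]) (auto simp: cohn_elkies_admissible_def)
  moreover have "((\<lambda>s. s ^ DIM('a) * f 0) \<longlongrightarrow> (r / 2) ^ DIM('a) * f 0) (at_right (r / 2))"
    by (intro tendsto_intros)
  ultimately show ?thesis
    by (intro tendsto_lowerbound[where F = "at_right (r / 2)"]) (auto simp: eventually_at_right_less eventually_at_filter)
qed

theorem corollary9p2:
  fixes r :: real
  assumes "odd CARD('n::finite)" and "CARD('n) \<ge> 5" and "r > 0"
  shows "cohn_elkies_bound TYPE('n) r \<ge> ereal (1 / (2 * (real CARD('n) + 1)))"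
  unfolding cohn_elkies_bound_def
proof (rule INF_greatest)
  fix f :: "real ^ 'n \<Rightarrow> real"
  assume "f \<in> {f. cohn_elkies_admissible r f}"
  then show "ereal (1 / (2 * (real CARD('n) + 1))) \<le> ereal ((r / 2) ^ CARD('n) * f 0)"
    using admissible_bound[of r f] assms by simp
qed

end
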